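(* Let $G$ be an abelian group and let $\Gamma$ be a $G$-grading on $(\mathcal{A},-)$ which is compatible with the standard quartic grading $\Gamma_{SQ}$. Then $\Gamma$ is isomorphic either to $\Gamma_{SQ}(G,g_1,g_2)$ for some $g_1,g_2\in G$, or to $\Gamma_{SQ}(G,g,g_1,g_2)$ for some $g,g_1,g_2\in G$ with $g$ of order $2$ and $g_1^2=g_2^2=e$.
   Context: $\mathbb{F}$ is an algebraically closed field of characteristic different from $2,3,5$. Let $\mathcal{B}=\mathbb{F}\oplus\mathbb{F}\oplus\mathbb{F}\oplus\mathbb{F}$ with componentwise product, $t$ its trace (sum of the four coordinates), and $b^\theta=-b+\tfrac12 t(b)1$ for $b\in\mathcal{B}$. The split quartic Cayley algebra is the (nonassociative, unital) algebra with involution $\mathcal{A}=\mathcal{B}\oplus s\mathcal{B}=\{b_1+sb_2\mid b_1,b_2\in\mathcal{B}\}$, with product and involution $$(b_1+sb_2)(b_3+sb_4)=\big(b_1b_3+(b_2b_4^\theta)^\theta\big)+s\big(b_1^\theta b_4+(b_2^\theta b_3^\theta)^\theta\big),\qquad \overline{b_1+sb_2}=b_1-sb_2^\theta .$$ Write $s=s1$, $x_1=(1,1,-1,-1)$, $x_2=(1,-1,1,-1)$, $x_3=(1,-1,-1,1)\in\mathcal{B}$, $\mathcal{K}=\mathbb{F}1\oplus\mathbb{F}s$ (a subalgebra with $s^2=1$), $e_+=\tfrac12(1+s)$, $e_-=\tfrac12(1-s)$; $rx_i$ (for $r\in\mathcal{K}$) is the product in $\mathcal{A}$, and $\mathcal{A}=\mathcal{K}\oplus\mathcal{K}x_1\oplus\mathcal{K}x_2\oplus\mathcal{K}x_3$.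 For an abelian group $G$ with neutral element $e$, a $G$-grading on $(\mathcal{A},-)$ is a decomposition $\mathcal{A}=\bigoplus_{g\in G}\mathcal{A}_g$ into subspaces with $\mathcal{A}_g\mathcal{A}_h\subseteq\mathcal{A}_{gh}$ and $\overline{\mathcal{A}_g}\subseteq\mathcal{A}_g$; $\deg(x)=g$ means $x\in\mathcal{A}_g$. Two $G$-gradings on $(\mathcal{A},-)$, with components $\mathcal{A}_g$ and $\mathcal{A}'_g$, are isomorphic if there is an algebra automorphism $\varphi$ of $\mathcal{A}$ commuting with the involution with $\varphi(\mathcal{A}_g)=\mathcal{A}'_g$ for all $g\in G$. A $G$-grading $\mathcal{A}=\bigoplus_{g\in G}\mathcal{A}_g$ and an $H$-grading $\mathcal{A}=\bigoplus_{h\in H}\mathcal{A}'_h$ are compatible if $\mathcal{A}=\bigoplus_{(g,h)\in G\times H}\mathcal{A}_g\cap\mathcal{A}'_h$. The standard quartic grading $\Gamma_{SQ}$ is the $\mathbb{Z}_2^2$-grading with $\mathcal{A}_{(\bar0,\bar0)}=\mathcal{K}$, $\mathcal{A}_{(\bar0,\bar1)}=\mathcal{K}x_1$, $\mathcal{A}_{(\bar1,\bar0)}=\mathcal{K}x_2$, $\mathcal{A}_{(\bar1,\bar1)}=\mathcal{K}x_3$. $\Gamma_{SQ}(G,g_1,g_2)$ is the $G$-grading with $\deg(1)=\deg(s)=e$, $\deg(e_+x_1)=g_1$, $\deg(e_+x_2)=g_2$, $\deg(e_+x_3)=(g_1g_2)^{-1}$, $\deg(e_-x_1)=g_1^{-1}$,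 $\deg(e_-x_2)=g_2^{-1}$, $\deg(e_-x_3)=g_1g_2$. $\Gamma_{SQ}(G,g,g_1,g_2)$ (for $g$ of order $2$ and $g_1^2=g_2^2=e$) is the $G$-grading with $\deg(1)=e$, $\deg(s)=g$, $\deg(x_1)=g_1$, $\deg(x_2)=g_2$, $\deg(x_3)=g_1g_2$, $\deg(sx_1)=gg_1$, $\deg(sx_2)=gg_2$, $\deg(sx_3)=gg_1g_2$. *)

theory Defs
  imports
    "HOL-Analysis.Cartesian_Space"
    "HOL-Algebra.Multiplicative_Group"
    "HOL-Algebra.Elementary_Groups"
    "HOL-Computational_Algebra.Polynomial"
begin

section \<open>The split quartic Cayley algebra\<close>

text \<open>
  The algebra \<open>B\<close> is \<open>'a ^ 4\<close> with the componentwise product of the library. The pair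
  \<open>(b\<^sub>1, b\<^sub>2)\<close> stands for \<open>b\<^sub>1 + s b\<^sub>2\<close>.
\<close>

type_synonym 'a quartic = "('a ^ 4) \<times> ('a ^ 4)"

definition trace4 :: "'a::field ^ 4 \<Rightarrow> 'a" where
  "trace4 b = (\<Sum>i\<in>UNIV. b $ i)"

definition theta :: "'a::field ^ 4 \<Rightarrow> 'a ^ 4" where
  "theta b = - b + (1 / 2 * trace4 b) *s 1"

fun q_mult :: "'a::field quartic \<Rightarrow> 'a quartic \<Rightarrow> 'a quartic" (infixl "\<bullet>\<^sub>q" 70) where
  "(b1, b2) \<bullet>\<^sub>q (b3, b4) =
     (b1 * b3 + theta (b2 * theta b4), theta b1 * b4 + theta (theta b2 * theta b3))"

fun q_inv :: "'a::field quartic \<Rightarrow> 'a quartic" where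
  "q_inv (b1, b2) = (b1, - theta b2)"

fun q_scale :: "'a::field \<Rightarrow> 'a quartic \<Rightarrow> 'a quartic" where
  "q_scale c (b1, b2) = (c *s b1, c *s b2)"

interpretation quartic: vector_space "q_scale :: 'a::field \<Rightarrow> 'a quartic \<Rightarrow> 'a quartic"
  by standard (auto simp: vec.scale_right_distrib vec.scale_left_distrib)

definition q_one :: "'a::field quartic" where "q_one = (1, 0)"
definition q_s :: "'a::field quartic" where "q_s = (0, 1)"
definition q_x1 :: "'a::field quartic" where "q_x1 = (vector [1, 1, -1, -1], 0)"
definition q_x2 :: "'a::field quartic" where "q_x2 = (vector [1, -1, 1, -1], 0)"
definition q_x3 :: "'a::field quartic" where "q_x3 = (vector [1, -1, -1, 1], 0)"
definition e_plus :: "'a::field quartic" where "e_plus = q_scale (1 / 2) (q_one + q_s)"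
definition e_minus :: "'a::field quartic" where "e_minus = q_scale (1 / 2) (q_one - q_s)"

definition q_K :: "'a::field quartic set" where
  "q_K = quartic.span {q_one, q_s}"

section \<open>Gradings\<close>

text \<open>
  Components of a family are only relevant at indices in \<open>I\<close> (for a \<open>G\<close>-grading, in
  \<open>carrier G\<close>). Since \<open>I\<close> may be infinite, decompositions are finitely supported.
\<close>

definition is_direct_sum :: "'i set \<Rightarrow> ('i \<Rightarrow> 'a::field quartic set) \<Rightarrow> bool" where
  "is_direct_sum I V \<longleftrightarrow>
     (\<forall>i\<in>I. quartic.subspace (V i)) \<and>
     (\<forall>x. \<exists>!f. (\<forall>i\<in>I. f i \<in> V i) \<and> (\<forall>i. i \<notin> I \<longrightarrow> f i = 0) \<and>
               finite {i. f i \<noteq> 0} \<and> (\<Sum>i\<in>{i. f i \<noteq> 0}. f i) = x)"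

definition is_grading :: "('g, 'm) monoid_scheme \<Rightarrow> ('g \<Rightarrow> 'a::field quartic set) \<Rightarrow> bool" where
  "is_grading G \<Gamma> \<longleftrightarrow>
     is_direct_sum (carrier G) \<Gamma> \<and>
     (\<forall>g\<in>carrier G. \<forall>h\<in>carrier G. \<forall>x\<in>\<Gamma> g. \<forall>y\<in>\<Gamma> h. x \<bullet>\<^sub>q y \<in> \<Gamma> (g \<otimes>\<^bsub>G\<^esub> h)) \<and>
     (\<forall>g\<in>carrier G. q_inv ` \<Gamma> g \<subseteq> \<Gamma> g)"

definition q_automorphism :: "('a::field quartic \<Rightarrow> 'a quartic) \<Rightarrow> bool" where
  "q_automorphism \<phi> \<longleftrightarrow>
     Vector_Spaces.linear q_scale q_scale \<phi> \<and> bij \<phi> \<and>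
     (\<forall>x y. \<phi> (x \<bullet>\<^sub>q y) = \<phi> x \<bullet>\<^sub>q \<phi> y) \<and> (\<forall>x. \<phi> (q_inv x) = q_inv (\<phi> x))"

definition isomorphic_gradings ::
  "('g, 'm) monoid_scheme \<Rightarrow> ('g \<Rightarrow> 'a::field quartic set) \<Rightarrow> ('g \<Rightarrow> 'a quartic set) \<Rightarrow> bool" where
  "isomorphic_gradings G \<Gamma> \<Gamma>' \<longleftrightarrow>
     (\<exists>\<phi>. q_automorphism \<phi> \<and> (\<forall>g\<in>carrier G. \<phi> ` \<Gamma> g = \<Gamma>' g))"

definition compatible_gradings ::
  "('g, 'm) monoid_scheme \<Rightarrow> ('g \<Rightarrow> 'a::field quartic set) \<Rightarrow>
   ('h, 'n) monoid_scheme \<Rightarrow> ('h \<Rightarrow> 'a quartic set) \<Rightarrow> bool" where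
  "compatible_gradings G \<Gamma> H \<Delta> \<longleftrightarrow>
     is_direct_sum (carrier G \<times> carrier H) (\<lambda>(g, h). \<Gamma> g \<inter> \<Delta> h)"

definition Z2_squared :: "(int \<times> int) monoid" where
  "Z2_squared = integer_mod_group 2 \<times>\<times> integer_mod_group 2"

definition Gamma_SQ :: "int \<times> int \<Rightarrow> 'a::field quartic set" where
  "Gamma_SQ d =
     (if d = (0, 0) then q_K
      else if d = (0, 1) then (\<lambda>r. r \<bullet>\<^sub>q q_x1) ` q_K
      else if d = (1, 0) then (\<lambda>r. r \<bullet>\<^sub>q q_x2) ` q_K
      else if d = (1, 1) then (\<lambda>r. r \<bullet>\<^sub>q q_x3) ` q_K
      else {0})"

text \<open>
  A grading prescribed by the degrees of the members of a basis of the algebra: the component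
  of degree \<open>g\<close> is spanned by the basis members of degree \<open>g\<close> (several members may share
  a degree).
\<close>

definition grading_from_degrees :: "('a::field quartic \<times> 'g) set \<Rightarrow> 'g \<Rightarrow> 'a quartic set" where
  "grading_from_degrees D g = quartic.span {x. (x, g) \<in> D}"

definition Gamma_SQ2 ::
  "('g, 'm) monoid_scheme \<Rightarrow> 'g \<Rightarrow> 'g \<Rightarrow> 'g \<Rightarrow> 'a::field quartic set" where
  "Gamma_SQ2 G g1 g2 = grading_from_degrees
     {(q_one, \<one>\<^bsub>G\<^esub>), (q_s, \<one>\<^bsub>G\<^esub>),
      (e_plus \<bullet>\<^sub>q q_x1, g1), (e_plus \<bullet>\<^sub>q q_x2, g2),
      (e_plus \<bullet>\<^sub>q q_x3, inv\<^bsub>G\<^esub> (g1 \<otimes>\<^bsub>G\<^esub> g2)),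
      (e_minus \<bullet>\<^sub>q q_x1, inv\<^bsub>G\<^esub> g1), (e_minus \<bullet>\<^sub>q q_x2, inv\<^bsub>G\<^esub> g2),
      (e_minus \<bullet>\<^sub>q q_x3, g1 \<otimes>\<^bsub>G\<^esub> g2)}"

definition Gamma_SQ3 ::
  "('g, 'm) monoid_scheme \<Rightarrow> 'g \<Rightarrow> 'g \<Rightarrow> 'g \<Rightarrow> 'g \<Rightarrow> 'a::field quartic set" where
  "Gamma_SQ3 G g g1 g2 = grading_from_degrees
     {(q_one, \<one>\<^bsub>G\<^esub>), (q_s, g),
      (q_x1, g1), (q_x2, g2), (q_x3, g1 \<otimes>\<^bsub>G\<^esub> g2),
      (q_s \<bullet>\<^sub>q q_x1, g \<otimes>\<^bsub>G\<^esub> g1), (q_s \<bullet>\<^sub>q q_x2, g \<otimes>\<^bsub>G\<^esub> g2),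
      (q_s \<bullet>\<^sub>q q_x3, g \<otimes>\<^bsub>G\<^esub> g1 \<otimes>\<^bsub>G\<^esub> g2)}"

end

theory Submission
  imports Defs
begin

text \<open>
  The argument runs in the basis \<open>e\<^sub>+, e\<^sub>-, p\<^sub>i = e\<^sub>+ x\<^sub>i, m\<^sub>i = e\<^sub>- x\<^sub>i\<close> (\<open>i = 1, 2, 3\<close>), in which the
  algebra looks like a Zorn vector-matrix algebra: \<open>e\<^sub>+\<close> and \<open>e\<^sub>-\<close> are orthogonal idempotents,
  \<open>p\<^sub>i m\<^sub>i = e\<^sub>+\<close>, \<open>m\<^sub>i p\<^sub>i = e\<^sub>-\<close>, and for distinct indices \<open>p\<^sub>i p\<^sub>j = m\<^sub>k\<close> and \<open>m\<^sub>i m\<^sub>j = p\<^sub>k\<close>, while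
  \<open>p\<^sub>i m\<^sub>j\<close>, \<open>m\<^sub>i p\<^sub>j\<close>, \<open>p\<^sub>i p\<^sub>i\<close> and \<open>m\<^sub>i m\<^sub>i\<close> vanish. The involution swaps \<open>e\<^sub>+\<close> with \<open>e\<^sub>-\<close> and
  fixes every \<open>p\<^sub>i\<close> and \<open>m\<^sub>i\<close>.

  Compatibility means that the algebra is spanned by elements that are homogeneous and lie in \<open>K\<close>
  or in one of the planes \<open>K x\<^sub>i\<close>. Hence every nonzero linear functional is nonzero on such an
  element (\<open>homogeneous_with_coord\<close>), and this is the only use of compatibility. Since the
  components are stable under the involution, the symmetric and skew parts of such elements of \<open>K\<close>
  show that \<open>1\<close> has degree \<open>e\<close> and that \<open>s\<close> is homogeneous of some degree \<open>g\<close>; \<open>s\<^sup>2 = 1\<close> gives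
  \<open>g\<^sup>2 = e\<close>.

  If \<open>g = e\<close>, then \<open>e\<^sub>+\<close> and \<open>e\<^sub>-\<close> have degree \<open>e\<close>. Multiplication by them preserves the
  components, so all \<open>p\<^sub>i\<close> and \<open>m\<^sub>i\<close> are homogeneous. Their products fix the degrees as in the first
  family, and the identity is an isomorphism (\<open>grading_with_s_of_trivial_degree\<close>).

  If \<open>g \<noteq> e\<close>, let \<open>u = c p\<^sub>i + d m\<^sub>i\<close> be homogeneous and nonzero. If \<open>c\<close> or \<open>d\<close> were \<open>0\<close>, then
  \<open>s u = u\<close> or \<open>s u = - u\<close>, although the degrees of \<open>u\<close> and \<open>s u\<close> differ by \<open>g\<close>. So \<open>u\<^sup>2 = c d 1\<close> is
  nonzero, the degree of \<open>u\<close> squares to \<open>e\<close>, and \<open>u\<close> can be rescaled so that \<open>c d = 1\<close>. The algebra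
  has a two-dimensional torus of automorphisms that scale \<open>p\<^sub>i\<close> by \<open>\<lambda>\<^sub>i\<close> and \<open>m\<^sub>i\<close> by the inverse of
  \<open>\<lambda>\<^sub>i\<close>, where \<open>\<lambda>\<^sub>1 \<lambda>\<^sub>2 \<lambda>\<^sub>3 = 1\<close>; a suitable member moves the homogeneous elements to
  \<open>x\<^sub>1\<close>, \<open>x\<^sub>2\<close> and hence to \<open>x\<^sub>3 = x\<^sub>1 x\<^sub>2\<close> (\<open>grading_with_s_of_nontrivial_degree\<close>).

  In both cases the degrees of a homogeneous spanning family determine the whole grading
  (\<open>isomorphic_to_grading_from_degrees\<close>).
\<close>

section \<open>Zorn coordinates\<close>

text \<open>
  The combination \<open>u\<^sub>0 1 + u\<^sub>1 x\<^sub>1 + u\<^sub>2 x\<^sub>2 + u\<^sub>3 x\<^sub>3\<close>. The vectors \<open>1, x\<^sub>1, x\<^sub>2, x\<^sub>3\<close> are the characters of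
  the Klein four-group, so the componentwise product becomes that of its group algebra.
\<close>

definition char_comb :: "'a::field \<Rightarrow> 'a \<Rightarrow> 'a \<Rightarrow> 'a \<Rightarrow> 'a ^ 4" where
  "char_comb u0 u1 u2 u3 =
     vector [u0 + u1 + u2 + u3, u0 + u1 - u2 - u3, u0 - u1 + u2 - u3, u0 - u1 - u2 + u3]"

lemma vector_4_nth [simp]:
  "(vector [a, b, c, d] :: 'a::zero ^ 4) $ 1 = a"
  "(vector [a, b, c, d] :: 'a::zero ^ 4) $ 2 = b"
  "(vector [a, b, c, d] :: 'a::zero ^ 4) $ 3 = c"
  "(vector [a, b, c, d] :: 'a::zero ^ 4) $ 4 = d"
  by (simp_all add: vector_def)

lemma char_comb_nth [simp]:
  "char_comb u0 u1 u2 u3 $ 1 = u0 + u1 + u2 + u3"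
  "char_comb u0 u1 u2 u3 $ 2 = u0 + u1 - u2 - u3"
  "char_comb u0 u1 u2 u3 $ 3 = u0 - u1 + u2 - u3"
  "char_comb u0 u1 u2 u3 $ 4 = u0 - u1 - u2 + u3"
  by (simp_all add: char_comb_def)

lemma char_comb_add:
  "char_comb u0 u1 u2 u3 + char_comb v0 v1 v2 v3 = char_comb (u0 + v0) (u1 + v1) (u2 + v2) (u3 + v3)"
  by (simp add: vec_eq_iff forall_4)

lemma char_comb_scale:
  "k *s char_comb u0 u1 u2 u3 = char_comb (k * u0) (k * u1) (k * u2) (k * u3)"
  by (simp add: vec_eq_iff forall_4 algebra_simps)

lemma char_comb_uminus:
  "- char_comb u0 u1 u2 u3 = char_comb (- u0) (- u1) (- u2) (- u3)"
  by (simp add: vec_eq_iff forall_4)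

lemma char_comb_mult:
  "char_comb u0 u1 u2 u3 * char_comb v0 v1 v2 v3 =
     char_comb (u0 * v0 + u1 * v1 + u2 * v2 + u3 * v3) (u0 * v1 + u1 * v0 + u2 * v3 + u3 * v2)
       (u0 * v2 + u2 * v0 + u1 * v3 + u3 * v1) (u0 * v3 + u3 * v0 + u1 * v2 + u2 * v1)"
  by (simp add: vec_eq_iff forall_4 algebra_simps)

text \<open>The characters \<open>x\<^sub>i\<close> have trace \<open>0\<close> and \<open>1\<close> has trace \<open>4\<close>, which makes \<open>theta\<close> diagonal.\<close>

lemma char_comb_theta:
  assumes "(2::'a::field) \<noteq> 0"
  shows "theta (char_comb u0 u1 u2 u3 :: 'a ^ 4) = char_comb u0 (- u1) (- u2) (- u3)"
proof -
  have "trace4 (char_comb u0 u1 u2 u3 :: 'a ^ 4) = 2 * (2 * u0)"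
    by (simp add: trace4_def sum_4)
  then have "1 / 2 * trace4 (char_comb u0 u1 u2 u3 :: 'a ^ 4) = 2 * u0"
    using assms by simp
  then show ?thesis
    by (simp add: theta_def vec_eq_iff forall_4)
qed

text \<open>
  The tuple \<open>(a, b, c, d)\<close> stands for
  \<open>a e\<^sub>+ + b e\<^sub>- + \<Sum>\<^sub>i (c\<^sub>i p\<^sub>i + d\<^sub>i m\<^sub>i)\<close>. The halves come from \<open>e\<^sub>+ = (1 + s) / 2\<close> and
  \<open>e\<^sub>- = (1 - s) / 2\<close>.
\<close>

type_synonym 'a zorn_coords = "'a \<times> 'a \<times> ('a \<times> 'a \<times> 'a) \<times> ('a \<times> 'a \<times> 'a)"

fun zorn :: "'a::field zorn_coords \<Rightarrow> 'a quartic" where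
  "zorn (a, b, (c1, c2, c3), (d1, d2, d3)) =
     (char_comb ((a + b) / 2) ((c1 + d1) / 2) ((c2 + d2) / 2) ((c3 + d3) / 2),
      char_comb ((a - b) / 2) ((c1 - d1) / 2) ((c2 - d2) / 2) ((c3 - d3) / 2))"

lemma zorn_add:
  "zorn (a, b, (c1, c2, c3), (d1, d2, d3)) + zorn (a', b', (c1', c2', c3'), (d1', d2', d3')) =
   zorn (a + a', b + b', (c1 + c1', c2 + c2', c3 + c3'), (d1 + d1', d2 + d2', d3 + d3'))"
  by (simp add: char_comb_add add_divide_distrib diff_divide_distrib algebra_simps)

lemma zorn_scale:
  "q_scale k (zorn (a, b, (c1, c2, c3), (d1, d2, d3))) =
   zorn (k * a, k * b, (k * c1, k * c2, k * c3), (k * d1, k * d2, k * d3))"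
  by (simp add: char_comb_scale algebra_simps)

context
  assumes two: "(2::'a::field) \<noteq> 0"
begin

lemma zorn_inv:
  "q_inv (zorn (a, b, (c1, c2, c3), (d1, d2, d3 :: 'a))) = zorn (b, a, (c1, c2, c3), (d1, d2, d3))"
  by (simp add: char_comb_theta[OF two] char_comb_uminus add.commute minus_divide_left)

lemma zorn_mult:
  "zorn (a, b, (c1, c2, c3), (d1, d2, d3 :: 'a)) \<bullet>\<^sub>q zorn (a', b', (c1', c2', c3'), (d1', d2', d3')) =
   zorn (a * a' + c1 * d1' + c2 * d2' + c3 * d3', b * b' + d1 * c1' + d2 * c2' + d3 * c3',
     (a * c1' + b' * c1 + (d2 * d3' + d3 * d2'),
      a * c2' + b' * c2 + (d1 * d3' + d3 * d1'),
      a * c3' + b' * c3 + (d1 * d2' + d2 * d1')),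
     (b * d1' + a' * d1 + (c2 * c3' + c3 * c2'),
      b * d2' + a' * d2 + (c1 * c3' + c3 * c1'),
      b * d3' + a' * d3 + (c1 * c2' + c2 * c1')))"
proof -
  have half: "x / 2 + x / 2 = x" for x :: 'a
    using two by (metis mult_2 add_divide_distrib nonzero_mult_div_cancel_left)
  \<comment> \<open>Doubled coordinates clear the denominators, which leaves polynomial identities.\<close>
  obtain A B C1 C2 C3 D1 D2 D3 where L:
    "a = A + A" "b = B + B" "c1 = C1 + C1" "c2 = C2 + C2" "c3 = C3 + C3"
    "d1 = D1 + D1" "d2 = D2 + D2" "d3 = D3 + D3"
    by (metis half)
  obtain A' B' C1' C2' C3' D1' D2' D3' where R:
    "a' = A' + A'" "b' = B' + B'" "c1' = C1' + C1'" "c2' = C2' + C2'" "c3' = C3' + C3'"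
    "d1' = D1' + D1'" "d2' = D2' + D2'" "d3' = D3' + D3'"
    by (metis half)
  have s: "(x + x + (y + y)) / 2 = x + y" "(x + x - (y + y)) / 2 = x - y" 
    for x y :: 'a
    using two by (simp_all add: field_simps)
  have e: "x / 2 = y \<longleftrightarrow> x = y + y" for x y :: 'a
    using two by (auto simp: field_simps)
  have cc: "char_comb x0 x1 x2 x3 = char_comb y0 y1 y2 y3" if "x0 = y0" "x1 = y1" "x2 = y2" "x3 = y3"
    for x0 x1 x2 x3 y0 y1 y2 y3 :: 'a
    using that by simp
  show ?thesis
    unfolding L R
    by (simp only: zorn.simps q_mult.simps s char_comb_theta[OF two] char_comb_mult char_comb_add
          prod.inject)
       (intro conjI cc; rule e[THEN iffD2, symmetric]; simp add: algebra_simps)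
qed

lemma half_sum_diff:
  "(r + t) / 2 + (r - t) / 2 = (r :: 'a)"
  "(r + t) / 2 - (r - t) / 2 = t"
proof -
  have "(r + t) / 2 + (r - t) / 2 = (2 * r) / 2"
    unfolding add_divide_distrib[symmetric] by (simp add: algebra_simps)
  then show "(r + t) / 2 + (r - t) / 2 = r"
    using two by simp
  have "(r + t) / 2 - (r - t) / 2 = (2 * t) / 2"
    unfolding diff_divide_distrib[symmetric] by (simp add: algebra_simps)
  then show "(r + t) / 2 - (r - t) / 2 = t"
    using two by simp
qed

lemma char_comb_eq_iff:
  "char_comb u0 u1 u2 (u3 :: 'a) = char_comb v0 v1 v2 v3 \<longleftrightarrow> u0 = v0 \<and> u1 = v1 \<and> u2 = v2 \<and> u3 = v3"
  (is "?L \<longleftrightarrow> ?R")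
proof
  assume ?L
  then have eq: "char_comb u0 u1 u2 u3 $ k = char_comb v0 v1 v2 v3 $ k" for k
    by simp
  \<comment> \<open>Character orthogonality recovers four times each coefficient from the entries.\<close>
  have cancel: "x = y" if "2 * (2 * x) = 2 * (2 * y)" for x y :: 'a
    using that two by (metis mult_left_cancel)
  have invert:
    "2 * (2 * w0) = w $ 1 + w $ 2 + w $ 3 + w $ 4" "2 * (2 * w1) = w $ 1 + w $ 2 - w $ 3 - w $ 4"
    "2 * (2 * w2) = w $ 1 - w $ 2 + w $ 3 - w $ 4" "2 * (2 * w3) = w $ 1 - w $ 2 - w $ 3 + w $ 4"
    if "w = char_comb w0 w1 w2 w3" for w :: "'a ^ 4" and w0 w1 w2 w3
    unfolding that char_comb_nth by (simp_all add: algebra_simps)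
  have "2 * (2 * u0) = 2 * (2 * v0)" "2 * (2 * u1) = 2 * (2 * v1)"
       "2 * (2 * u2) = 2 * (2 * v2)" "2 * (2 * u3) = 2 * (2 * v3)"
    using invert[of "char_comb u0 u1 u2 u3", OF refl] invert[of "char_comb v0 v1 v2 v3", OF refl]
    unfolding eq by (simp_all only:)
  then show ?R
    using cancel by blast
qed simp

lemma zorn_eq_iff:
  "zorn (a, b, (c1, c2, c3), (d1, d2, d3 :: 'a)) = zorn (a', b', (c1', c2', c3'), (d1', d2', d3')) \<longleftrightarrow>
   a = a' \<and> b = b' \<and> c1 = c1' \<and> c2 = c2' \<and> c3 = c3' \<and> d1 = d1' \<and> d2 = d2' \<and> d3 = d3'"
proof -
  have half_pair: "(x + y) / 2 = (x' + y') / 2 \<and> (x - y) / 2 = (x' - y') / 2 \<longleftrightarrow> x = x' \<and> y = y'"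
    for x y x' y' :: 'a
  proof
    assume h: "(x + y) / 2 = (x' + y') / 2 \<and> (x - y) / 2 = (x' - y') / 2"
    have "x = (x + y) / 2 + (x - y) / 2" "y = (x + y) / 2 - (x - y) / 2"
      by (simp_all only: half_sum_diff)
    then show "x = x' \<and> y = y'"
      unfolding h[THEN conjunct1] h[THEN conjunct2] by (simp only: half_sum_diff)
  qed simp
  have "zorn (a, b, (c1, c2, c3), (d1, d2, d3)) = zorn (a', b', (c1', c2', c3'), (d1', d2', d3')) \<longleftrightarrow>
      ((a + b) / 2 = (a' + b') / 2 \<and> (a - b) / 2 = (a' - b') / 2) \<and>
      ((c1 + d1) / 2 = (c1' + d1') / 2 \<and> (c1 - d1) / 2 = (c1' - d1') / 2) \<and>
      ((c2 + d2) / 2 = (c2' + d2') / 2 \<and> (c2 - d2) / 2 = (c2' - d2') / 2) \<and>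
      ((c3 + d3) / 2 = (c3' + d3') / 2 \<and> (c3 - d3) / 2 = (c3' - d3') / 2)"
    by (simp only: zorn.simps prod.inject char_comb_eq_iff conj_ac)
  also have "\<dots> \<longleftrightarrow> a = a' \<and> b = b' \<and> c1 = c1' \<and> c2 = c2' \<and> c3 = c3' \<and> d1 = d1' \<and> d2 = d2' \<and> d3 = d3'"
    by (simp only: half_pair) (simp only: conj_ac)
  finally show ?thesis .
qed

lemma char_comb_surj: "\<exists>u0 u1 u2 u3. (b :: 'a ^ 4) = char_comb u0 u1 u2 u3"
proof -
  have four: "x = (2 * (2 * x)) / (2 * 2)" for x :: 'a
    using two no_zero_divisors[OF two two]
    by (metis mult.assoc nonzero_mult_div_cancel_left)
  have "b = char_comb ((b$1 + b$2 + b$3 + b$4) / (2 * 2)) ((b$1 + b$2 - b$3 - b$4) / (2 * 2))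
              ((b$1 - b$2 + b$3 - b$4) / (2 * 2)) ((b$1 - b$2 - b$3 + b$4) / (2 * 2))"
    unfolding vec_eq_iff forall_4 char_comb_nth
      add_divide_distrib[symmetric] diff_divide_distrib[symmetric]
    by (intro conjI; subst four; intro arg_cong2[where f = "(/)"] refl) (simp_all add: algebra_simps)
  then show ?thesis by blast
qed

lemma zorn_surj: "\<exists>a b c1 c2 c3 d1 d2 d3. (x :: 'a quartic) = zorn (a, b, (c1, c2, c3), (d1, d2, d3))"
proof -
  obtain u0 u1 u2 u3 v0 v1 v2 v3 where "x = (char_comb u0 u1 u2 u3, char_comb v0 v1 v2 v3)"
    by (metis char_comb_surj prod.exhaust)
  moreover have "(u + v + (u - v)) / 2 = u" "(u + v - (u - v)) / 2 = v" for u v :: 'a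
    using two by (simp_all add: field_simps)
  ultimately have "x = zorn (u0 + v0, u0 - v0, (u1 + v1, u2 + v2, u3 + v3), (u1 - v1, u2 - v2, u3 - v3))"
    by simp
  then show ?thesis by blast
qed

lemma bij_zorn: "bij (zorn :: 'a zorn_coords \<Rightarrow> _)"
proof (rule bijI)
  show "inj (zorn :: 'a zorn_coords \<Rightarrow> _)"
    by (auto intro!: injI simp: zorn_eq_iff simp del: zorn.simps)
  show "surj (zorn :: 'a zorn_coords \<Rightarrow> _)"
    unfolding surj_def using zorn_surj by blast
qed

end

definition zorn_coords :: "'a::field quartic \<Rightarrow> 'a zorn_coords" where
  "zorn_coords = inv_into UNIV zorn"

lemma zorn_coords_zorn: "(2::'a::field) \<noteq> 0 \<Longrightarrow> zorn_coords (zorn t) = (t :: 'a zorn_coords)"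
  by (simp add: zorn_coords_def bij_zorn bij_is_inj)

declare zorn.simps [simp del]

lemma zorn_coords_add:
  assumes "(2::'a::field) \<noteq> 0"
  shows "zorn_coords (x + y :: 'a quartic) = zorn_coords x + zorn_coords y"
proof -
  obtain a b c1 c2 c3 d1 d2 d3 where "x = zorn (a, b, (c1, c2, c3), (d1, d2, d3))"
    using zorn_surj[OF assms] by blast
  moreover obtain a' b' c1' c2' c3' d1' d2' d3' where "y = zorn (a', b', (c1', c2', c3'), (d1', d2', d3'))"
    using zorn_surj[OF assms] by blast
  ultimately show ?thesis
    by (simp add: zorn_add zorn_coords_zorn[OF assms])
qed

section \<open>The components of the standard quartic grading\<close>

text \<open>
  \<open>kk a b = a e\<^sub>+ + b e\<^sub>-\<close> is the general element of \<open>K\<close>, and below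
  \<open>kx i c d = c p\<^sub>i + d m\<^sub>i\<close> (for \<open>i = 1, 2, 3\<close>) that of \<open>K x\<^sub>i\<close>.
\<close>

definition kk :: "'a::field \<Rightarrow> 'a \<Rightarrow> 'a quartic" where
  "kk a b = zorn (a, b, (0, 0, 0), (0, 0, 0))"

definition kx :: "nat \<Rightarrow> 'a::field \<Rightarrow> 'a \<Rightarrow> 'a quartic" where
  "kx i c d = zorn (0, 0, (of_bool (i = 1) * c, of_bool (i = 2) * c, of_bool (i = 3) * c),
                          (of_bool (i = 1) * d, of_bool (i = 2) * d, of_bool (i = 3) * d))"

lemma zorn_decomp:
  "zorn (a, b, (c1, c2, c3), (d1, d2, d3)) = kk a b + kx 1 c1 d1 + kx 2 c2 d2 + kx 3 c3 d3"
  by (simp add: kk_def kx_def zorn_add)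

lemma kk_add: "kk a b + kk a' b' = kk (a + a') (b + b')"
  and kx_add: "kx i c d + kx i c' d' = kx i (c + c') (d + d')"
  and kk_scale: "q_scale r (kk a b) = kk (r * a) (r * b)"
  and kx_scale: "q_scale r (kx i c d) = kx i (r * c) (r * d)"
  by (simp_all add: kk_def kx_def zorn_add zorn_scale algebra_simps)

lemma kk_zero: "kk 0 0 = 0"
  and kx_zero: "kx i 0 0 = 0"
  by (simp_all add: kk_def kx_def zorn.simps vec_eq_iff forall_4 zero_prod_def)

lemma kk_diff: "kk a b - kk a' b' = kk (a - a') (b - b')"
  by (simp only: diff_eq_eq kk_add diff_add_cancel)

context
  assumes two: "(2::'a::field) \<noteq> 0"
begin

lemma kk_eq_iff: "kk a (b :: 'a) = kk a' b' \<longleftrightarrow> a = a' \<and> b = b'"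
  by (simp add: kk_def zorn_eq_iff[OF two])

lemma kx_eq_iff: "i \<in> {1, 2, 3} \<Longrightarrow> kx i c (d :: 'a) = kx i c' d' \<longleftrightarrow> c = c' \<and> d = d'"
  by (auto simp: kx_def zorn_eq_iff[OF two])

lemma kk_inv: "q_inv (kk a (b :: 'a)) = kk b a"
  by (simp add: kk_def zorn_inv[OF two])

lemma kk_kk: "kk a (b :: 'a) \<bullet>\<^sub>q kk a' b' = kk (a * a') (b * b')"
  by (simp add: kk_def zorn_mult[OF two])

lemma kk_kx: "kk a (b :: 'a) \<bullet>\<^sub>q kx i c d = kx i (a * c) (b * d)"
  by (simp add: kk_def kx_def zorn_mult[OF two])

lemma kx_kx_same: "i \<in> {1, 2, 3} \<Longrightarrow> kx i c (d :: 'a) \<bullet>\<^sub>q kx i c' d' = kk (c * d') (d * c')"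
  by (auto simp: kk_def kx_def zorn_mult[OF two])

lemma kx_kx_12: "kx 1 c (d :: 'a) \<bullet>\<^sub>q kx 2 c' d' = kx 3 (d * d') (c * c')"
  by (simp add: kx_def zorn_mult[OF two])

lemma q_one_kk: "q_one = kk 1 (1 :: 'a)"
  and q_s_kk: "q_s = kk 1 (- 1 :: 'a)"
  and q_x1_kx: "q_x1 = kx 1 1 (1 :: 'a)"
  and q_x2_kx: "q_x2 = kx 2 1 (1 :: 'a)"
  and q_x3_kx: "q_x3 = kx 3 1 (1 :: 'a)"
  using two
  by (simp_all add: q_one_def q_s_def q_x1_def q_x2_def q_x3_def kk_def kx_def zorn.simps
      vec_eq_iff forall_4)

lemma e_plus_kk: "e_plus = kk 1 (0 :: 'a)"
  and e_minus_kk: "e_minus = kk 0 (1 :: 'a)"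
  using two
  by (simp_all add: e_plus_def e_minus_def q_one_kk q_s_kk kk_add kk_diff kk_scale)

lemmas generators_kk_kx = q_one_kk q_s_kk q_x1_kx q_x2_kx q_x3_kx e_plus_kk e_minus_kk

lemma Gamma_SQ_component:
  assumes "(y :: 'a quartic) \<in> Gamma_SQ h"
  shows "(\<exists>a b. y = kk a b) \<or> (\<exists>i\<in>{1, 2, 3}. \<exists>c d. y = kx i c d)"
proof -
  note zero = kk_zero[where 'a = 'a, symmetric]
  have K: "q_K \<subseteq> range (\<lambda>(a, b :: 'a). kk a b)"
    unfolding q_K_def
  proof (rule quartic.span_minimal)
    show "{q_one, q_s} \<subseteq> range (\<lambda>(a, b :: 'a). kk a b)"
      by (auto simp: q_one_kk q_s_kk image_iff)
    show "quartic.subspace (range (\<lambda>(a, b :: 'a). kk a b))"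
    proof (rule quartic.subspaceI)
      let ?k = "\<lambda>(a, b :: 'a). kk a b"
      show "0 \<in> range ?k"
        by (auto simp: zero)
      fix x y :: "'a quartic" and c
      assume "x \<in> range ?k" "y \<in> range ?k"
      then obtain p q where pq: "x = ?k p" "y = ?k q"
        by blast
      have "x + y = ?k (p + q)" "q_scale c x = ?k (c * fst p, c * snd p)"
        by (simp_all add: pq case_prod_unfold kk_add kk_scale)
      then show "x + y \<in> range ?k" "q_scale c x \<in> range ?k"
        by blast+
    qed
  qed
  consider "y \<in> q_K" | x where "x \<in> {q_x1, q_x2, q_x3}" "y \<in> (\<lambda>r. r \<bullet>\<^sub>q x) ` q_K" | "y = 0"
  proof -
    have "Gamma_SQ h = (q_K :: 'a quartic set) \<or>
        (\<exists>x\<in>{q_x1, q_x2, q_x3 :: 'a quartic}. Gamma_SQ h = (\<lambda>r. r \<bullet>\<^sub>q x) ` q_K) \<or>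
        Gamma_SQ h = {0 :: 'a quartic}"
      unfolding Gamma_SQ_def bex_simps by (simp split: if_split)
    then show ?thesis
      using assms that by blast
  qed
  then show ?thesis
  proof cases
    case 1
    then obtain p where "y = (\<lambda>(a, b). kk a b) p"
      using K by blast
    then show ?thesis
      by (auto simp: case_prod_unfold)
  next
    case (2 x)
    then obtain a b where "y = kk a b \<bullet>\<^sub>q x" using K by auto
    moreover have "\<exists>i\<in>{1, 2, 3}. x = kx i 1 1"
      using 2 by (auto simp: q_x1_kx q_x2_kx q_x3_kx)
    ultimately show ?thesis
      using kk_kx by blast
  next
    case 3
    then show ?thesis using zero by blast
  qed
qed

text \<open>
  The two alternatives are the two shapes of basis of \<open>K x\<^sub>i\<close> that occur in the model gradings:
  \<open>e\<^sub>+ x\<^sub>i, e\<^sub>- x\<^sub>i\<close> and \<open>x\<^sub>i, s x\<^sub>i\<close>.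
\<close>

lemma span_UNIV_criterion:
  fixes B :: "'a quartic set"
  assumes "q_one \<in> quartic.span B" "q_s \<in> quartic.span B"
    and "\<And>i. i \<in> {1, 2, 3} \<Longrightarrow>
           {kx i 1 0, kx i 0 1} \<subseteq> quartic.span B \<or> {kx i 1 1, kx i 1 (-1)} \<subseteq> quartic.span B"
  shows "quartic.span B = UNIV"
proof -
  have lin: "q_scale r x + q_scale t y \<in> quartic.span B" if "x \<in> quartic.span B" "y \<in> quartic.span B" for r t x y
    using that by (simp add: quartic.span_add quartic.span_scale)
  note half = half_sum_diff[OF two]
  have K: "kk a b \<in> quartic.span B" for a b
    using lin[OF assms(1,2), of "(a + b) / 2" "(a - b) / 2"]
    by (simp add: q_one_kk q_s_kk kk_scale kk_add half)
  have X: "kx i c d \<in> quartic.span B" if "i \<in> {1, 2, 3}" for i c d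
    using assms(3)[OF that]
  proof
    assume "{kx i 1 0, kx i 0 1} \<subseteq> quartic.span B"
    then show ?thesis
      using lin[of "kx i 1 0" "kx i 0 1" c d] by (simp add: kx_scale kx_add)
  next
    assume "{kx i 1 1, kx i 1 (-1)} \<subseteq> quartic.span B"
    then show ?thesis
      using lin[of "kx i 1 1" "kx i 1 (-1)" "(c + d) / 2" "(c - d) / 2"]
      by (simp add: kx_scale kx_add half)
  qed
  have "x \<in> quartic.span B" for x
  proof -
    obtain a b c1 c2 c3 d1 d2 d3 where "x = zorn (a, b, (c1, c2, c3), (d1, d2, d3))"
      using zorn_surj[OF two] by blast
    then show ?thesis
      by (simp only: zorn_decomp) (intro quartic.span_add K X; simp)
  qed
  then show ?thesis by blast
qed

end

section \<open>A torus of automorphisms\<close>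

text \<open>
  The third scaling factor is forced to be the inverse of \<open>l1 * l2\<close> by \<open>m\<^sub>1 m\<^sub>2 = p\<^sub>3\<close>, and those of
  the \<open>m\<^sub>i\<close> are inverse to those of the \<open>p\<^sub>i\<close> because \<open>p\<^sub>i m\<^sub>i = e\<^sub>+\<close> is fixed.
\<close>

fun torus_coords :: "'a::field \<Rightarrow> 'a \<Rightarrow> 'a zorn_coords \<Rightarrow> 'a zorn_coords" where
  "torus_coords l1 l2 (a, b, (c1, c2, c3), (d1, d2, d3)) =
     (a, b, (l1 * c1, l2 * c2, c3 / (l1 * l2)), (d1 / l1, d2 / l2, l1 * l2 * d3))"

definition torus :: "'a::field \<Rightarrow> 'a \<Rightarrow> 'a quartic \<Rightarrow> 'a quartic" where
  "torus l1 l2 x = zorn (torus_coords l1 l2 (zorn_coords x))"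

lemma torus_automorphism:
  assumes two: "(2::'a::field) \<noteq> 0" and l: "l1 \<noteq> (0::'a)" "l2 \<noteq> 0"
  shows "q_automorphism (torus l1 l2)"
proof -
  have torus_zorn: "torus r t (zorn (a, b, (c1, c2, c3), (d1, d2, d3 :: 'a))) =
     zorn (a, b, (r * c1, t * c2, c3 / (r * t)), (d1 / r, d2 / t, r * t * d3))" for r t a b c1 c2 c3 d1 d2 d3
    by (simp add: torus_def zorn_coords_zorn[OF two])
  note surj = zorn_surj[OF two]
  have "Vector_Spaces.linear q_scale q_scale (torus l1 l2)"
    unfolding Vector_Spaces.linear_iff
  proof (intro conjI allI)
    fix x y :: "'a quartic" and r
    obtain a b c1 c2 c3 d1 d2 d3 where x: "x = zorn (a, b, (c1, c2, c3), (d1, d2, d3))"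
      using surj by blast
    obtain a' b' c1' c2' c3' d1' d2' d3' where y: "y = zorn (a', b', (c1', c2', c3'), (d1', d2', d3'))"
      using surj by blast
    show "torus l1 l2 (x + y) = torus l1 l2 x + torus l1 l2 y"
      by (simp add: x y zorn_add torus_zorn add_divide_distrib distrib_left)
    show "torus l1 l2 (q_scale r x) = q_scale r (torus l1 l2 x)"
      by (simp add: x zorn_scale torus_zorn mult_ac)
  qed (rule quartic.vector_space_axioms)+
  moreover have "bij (torus l1 l2)"
  proof (rule o_bij)
    have "torus (1 / r) (1 / t) (torus r t x) = x" if "r \<noteq> 0" "t \<noteq> 0"
      for r t :: 'a and x
      using surj[of x] that by (auto simp: torus_zorn)
    from this[OF l] this[of "1 / l1" "1 / l2"] l
    show "torus (1 / l1) (1 / l2) \<circ> torus l1 l2 = id" "torus l1 l2 \<circ> torus (1 / l1) (1 / l2) = id"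
      by auto
  qed
  moreover have "torus l1 l2 (x \<bullet>\<^sub>q y) = torus l1 l2 x \<bullet>\<^sub>q torus l1 l2 y" for x y
  proof -
    obtain a b c1 c2 c3 d1 d2 d3 where x: "x = zorn (a, b, (c1, c2, c3), (d1, d2, d3))"
      using surj by blast
    obtain a' b' c1' c2' c3' d1' d2' d3' where y: "y = zorn (a', b', (c1', c2', c3'), (d1', d2', d3'))"
      using surj by blast
    show ?thesis
      unfolding x y zorn_mult[OF two] torus_zorn zorn_eq_iff[OF two]
      using l by (simp add: field_simps)
  qed
  moreover have "torus l1 l2 (q_inv x) = q_inv (torus l1 l2 x)" for x
    using surj[of x] by (auto simp: torus_zorn zorn_inv[OF two])
  ultimately show ?thesis
    by (simp add: q_automorphism_def)
qed

lemma torus_kk_kx: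
  assumes "(2::'a::field) \<noteq> 0"
  shows "torus l1 l2 (kk a (b::'a)) = kk a b"
    "torus l1 l2 (kx 1 c d) = kx 1 (l1 * c) (d / l1)"
    "torus l1 l2 (kx 2 c d) = kx 2 (l2 * c) (d / l2)"
    "torus l1 l2 (kx 3 c d) = kx 3 (c / (l1 * l2)) (l1 * l2 * d)"
  by (simp_all add: torus_def zorn_coords_zorn[OF assms] kk_def kx_def)

lemma id_automorphism: "q_automorphism id"
  by (simp add: q_automorphism_def Vector_Spaces.linear_iff quartic.vector_space_axioms)

section \<open>Direct sums and homogeneous spanning families\<close>

text \<open>
  The uniqueness of finitely supported decompositions, for sums over one common finite index set;
  extending by \<open>0\<close> outside that set reduces it to the definition.
\<close>

lemma direct_sum_unique:
  assumes V: "is_direct_sum I V" and S: "finite S" "S \<subseteq> I"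
    and f: "\<And>i. i \<in> S \<Longrightarrow> f i \<in> V i" and g: "\<And>i. i \<in> S \<Longrightarrow> g i \<in> V i"
    and eq: "sum f S = sum g S" and i: "i \<in> S"
  shows "f i = g i"
proof -
  define ext where "ext u = (\<lambda>j. if j \<in> S then u j else (0 :: 'b quartic))" for u
  have sub: "quartic.subspace (V j)" if "j \<in> I" for j
    using V that by (simp add: is_direct_sum_def)
  have ok: "(\<forall>j\<in>I. ext u j \<in> V j) \<and> (\<forall>j. j \<notin> I \<longrightarrow> ext u j = 0) \<and>
        finite {j. ext u j \<noteq> 0} \<and> (\<Sum>j\<in>{j. ext u j \<noteq> 0}. ext u j) = sum u S"
    if "\<And>j. j \<in> S \<Longrightarrow> u j \<in> V j" for u
  proof -
    have "{j. ext u j \<noteq> 0} \<subseteq> S"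
      by (auto simp: ext_def split: if_splits)
    moreover from this have "(\<Sum>j\<in>{j. ext u j \<noteq> 0}. ext u j) = sum (ext u) S"
      using S by (intro sum.mono_neutral_left) auto
    ultimately show ?thesis
      using S that quartic.subspace_0[OF sub] finite_subset by (fastforce simp: ext_def)
  qed
  have unique: "a = b" if "\<exists>!u. P u" "P a" "P b" for P and a b :: "'a \<Rightarrow> 'b quartic"
    using that by blast
  have "ext f = ext g"
    by (rule unique[OF conjunct2[OF V[unfolded is_direct_sum_def], THEN spec, of "sum f S"]
          ok[of f, OF f] ok[of g, OF g, folded eq]])
  then have "ext f i = ext g i"
    by (rule fun_cong)
  then show ?thesis
    using i by (simp add: ext_def)
qed

lemma direct_sum_disjoint:
  assumes V: "is_direct_sum I V" and "i \<in> I" "j \<in> I" "x \<in> V i" "x \<in> V j" "x \<noteq> 0"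
  shows "i = j"
proof (rule ccontr)
  assume "i \<noteq> j"
  have "0 \<in> V i" "0 \<in> V j"
    using assms quartic.subspace_0 by (auto simp: is_direct_sum_def)
  then have "(if i = i then x else 0) = (if i = j then x else 0)"
    using assms \<open>i \<noteq> j\<close>
    by (intro direct_sum_unique[OF V, of "{i, j}" "\<lambda>k. if k = i then x else 0" "\<lambda>k. if k = j then x else 0"])
       auto
  then show False
    using \<open>i \<noteq> j\<close> \<open>x \<noteq> 0\<close> by simp
qed

text \<open>The summands span, so an additive map that vanishes on each of them is zero.\<close>

lemma direct_sum_functional:
  fixes T :: "'a::field quartic \<Rightarrow> 'a"
  assumes V: "is_direct_sum I V" and T: "\<And>x y. T (x + y) = T x + T y" and "T z \<noteq> 0"
  shows "\<exists>i\<in>I. \<exists>y\<in>V i. T y \<noteq> 0"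
proof -
  obtain f where f: "\<forall>i\<in>I. f i \<in> V i" "\<forall>i. i \<notin> I \<longrightarrow> f i = 0" "(\<Sum>i\<in>{i. f i \<noteq> 0}. f i) = z"
    using ex1_implies_ex[OF conjunct2[OF V[unfolded is_direct_sum_def], THEN spec, of z]] by blast
  have "T 0 = 0"
    using T[of 0 0] by (metis add_0 add_cancel_right_right)
  then have "(\<Sum>i\<in>{i. f i \<noteq> 0}. T (f i)) = T z"
    using f(3) sum_comp_morphism[of T f "{i. f i \<noteq> 0}"] T by (simp add: o_def)
  then have "\<exists>i. f i \<noteq> 0 \<and> T (f i) \<noteq> 0"
    using \<open>T z \<noteq> 0\<close> by (metis (mono_tags, lifting) mem_Collect_eq sum.neutral)
  then show ?thesis
    using f by blast
qed

text \<open>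
  By linearity \<open>\<phi>\<close> maps the component of degree \<open>g\<close> onto a space containing the span of the members
  of degree \<open>g\<close> of the family. Conversely, since the family spans, the image of an element of that
  component is a sum of elements of these smaller spans, and uniqueness of decompositions leaves only
  the summand of degree \<open>g\<close>.
\<close>

lemma isomorphic_to_grading_from_degrees:
  assumes V: "is_direct_sum (carrier G) \<Gamma>" and \<phi>: "q_automorphism \<phi>" and D: "finite D"
    and hom: "\<And>x g. (x, g) \<in> D \<Longrightarrow> g \<in> carrier G \<and> (\<exists>y\<in>\<Gamma> g. \<phi> y = x)"
    and span: "quartic.span (fst ` D) = UNIV"
  shows "isomorphic_gradings G \<Gamma> (grading_from_degrees D)"
proof -
  have lin: "Vector_Spaces.linear q_scale q_scale \<phi>" and bij: "bij \<phi>"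
    using \<phi> by (auto simp: q_automorphism_def)
  interpret \<phi>: Vector_Spaces.linear q_scale q_scale \<phi>
    by (fact lin)
  let ?S = "snd ` D"
  have S: "finite ?S" "?S \<subseteq> carrier G"
    using D hom by auto
  have sub: "quartic.subspace (\<Gamma> g)" if "g \<in> carrier G" for g
    using V that by (simp add: is_direct_sum_def)
  have incl: "grading_from_degrees D g \<subseteq> \<phi> ` \<Gamma> g" if "g \<in> carrier G" for g
    unfolding grading_from_degrees_def
    using hom by (intro quartic.span_minimal \<phi>.subspace_image sub that) blast
  have zero: "0 \<in> grading_from_degrees D g" for g
    by (simp add: grading_from_degrees_def quartic.span_zero)
  have decomp: "\<exists>w. (\<forall>h. w h \<in> grading_from_degrees D h) \<and> sum w ?S = x" for x
  proof -
    have "x \<in> quartic.span (fst ` D)"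
      by (simp add: span)
    then show ?thesis
    proof (induction rule: quartic.span_induct_alt)
      case base
      show ?case
        using zero by (intro exI[of _ "\<lambda>_. 0"]) simp
    next
      case (step c x y)
      then obtain g where g: "(x, g) \<in> D"
        by auto
      obtain w where w: "\<forall>h. w h \<in> grading_from_degrees D h" "sum w ?S = y"
        using step by blast
      let ?u = "\<lambda>h. if h = g then q_scale c x else 0"
      have "?u h \<in> grading_from_degrees D h" for h
        using g by (auto simp: grading_from_degrees_def
            intro: quartic.span_zero quartic.span_scale quartic.span_base)
      moreover have "sum ?u ?S = q_scale c x"
        using S g by (force simp: sum.delta)
      ultimately show ?case
        using w unfolding grading_from_degrees_def
        by (intro exI[of _ "\<lambda>h. ?u h + w h"] conjI allI quartic.span_add) (simp_all add: sum.distrib)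
    qed
  qed
  have "\<phi> ` \<Gamma> g = grading_from_degrees D g" if g: "g \<in> carrier G" for g
  proof
    show "\<phi> ` \<Gamma> g \<subseteq> grading_from_degrees D g"
    proof (rule image_subsetI)
      fix y assume y: "y \<in> \<Gamma> g"
      obtain w where w: "\<forall>h. w h \<in> grading_from_degrees D h" "sum w ?S = \<phi> y"
        using decomp by blast
      have "\<forall>h\<in>carrier G. \<exists>v\<in>\<Gamma> h. \<phi> v = w h"
        using incl w by (metis image_iff subsetD)
      then obtain v where v: "\<And>h. h \<in> carrier G \<Longrightarrow> v h \<in> \<Gamma> h \<and> \<phi> (v h) = w h"
        by metis
      let ?T = "insert g ?S" and ?v = "\<lambda>h. if h \<in> ?S then v h else 0"
      have T: "finite ?T" "?T \<subseteq> carrier G"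
        using S g by auto
      have "\<phi> (sum ?v ?T) = sum (\<lambda>h. \<phi> (?v h)) ?T"
        by (rule \<phi>.sum)
      also have "\<dots> = sum w ?S"
        using S v by (intro sum.mono_neutral_cong_right) auto
      finally have "sum ?v ?T = y"
        using w bij by (simp add: bij_is_inj inj_eq)
      also have "y = sum (\<lambda>h. if h = g then y else 0) ?T"
        using T by (simp add: sum.delta)
      finally have "?v g = (if g = g then y else 0)"
        using T v y quartic.subspace_0[OF sub]
        by (intro direct_sum_unique[OF V T, of ?v "\<lambda>h. if h = g then y else 0"]) auto
      then have "\<phi> y = (if g \<in> ?S then w g else 0)"
        using v[OF g] by (auto split: if_splits)
      then show "\<phi> y \<in> grading_from_degrees D g"
        using w zero by auto
    qed
  qed (rule incl[OF g])
  then show ?thesis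
    using \<phi> by (auto simp: isomorphic_gradings_def)
qed

section \<open>Gradings compatible with the standard quartic grading\<close>

locale SQ_compatible_grading = comm_group G for G :: "('g, 'm) monoid_scheme" (structure) +
  fixes \<Gamma> :: "'g \<Rightarrow> 'a::field quartic set"
  assumes two: "(2::'a) \<noteq> 0"
    and grading: "is_grading G \<Gamma>"
    and compatible: "compatible_gradings G \<Gamma> Z2_squared Gamma_SQ"
begin

lemma direct_sum: "is_direct_sum (carrier G) \<Gamma>"
  using grading by (simp add: is_grading_def)

lemma subspace: "g \<in> carrier G \<Longrightarrow> quartic.subspace (\<Gamma> g)"
  using direct_sum by (simp add: is_direct_sum_def)

lemma mult_mem:
  "x \<in> \<Gamma> g \<Longrightarrow> y \<in> \<Gamma> h \<Longrightarrow> g \<in> carrier G \<Longrightarrow> h \<in> carrier G \<Longrightarrow> x \<bullet>\<^sub>q y \<in> \<Gamma> (g \<otimes> h)"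
  using grading by (simp add: is_grading_def)

lemma inv_mem: "x \<in> \<Gamma> g \<Longrightarrow> g \<in> carrier G \<Longrightarrow> q_inv x \<in> \<Gamma> g"
  using grading unfolding is_grading_def by blast

lemmas add_mem = quartic.subspace_add[OF subspace]
lemmas scale_mem = quartic.subspace_scale[OF subspace]
lemmas degree_unique = direct_sum_disjoint[OF direct_sum]

lemma kk_nonzero: "a \<noteq> 0 \<or> b \<noteq> 0 \<Longrightarrow> kk a (b::'a) \<noteq> 0"
  unfolding kk_zero[symmetric] kk_eq_iff[OF two] by simp

lemma kx_nonzero: "i \<in> {1,2,3} \<Longrightarrow> c \<noteq> 0 \<or> d \<noteq> 0 \<Longrightarrow> kx i c (d::'a) \<noteq> 0"
  using kx_eq_iff[OF two, of i c d 0 0] by (simp add: kx_zero)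

text \<open>
  The algebra is spanned by the intersections of components of the two gradings, so some element of
  such an intersection has nonzero image under any given nonzero additive function of the coordinates.
  Choosing the function selects the plane in which that element lies.
\<close>

lemma homogeneous_with_coord:
  fixes f :: "'a zorn_coords \<Rightarrow> 'a"
  assumes "\<And>t u. f (t + u) = f t + f u" and "f t \<noteq> 0"
  shows "\<exists>g\<in>carrier G. \<exists>y\<in>\<Gamma> g. f (zorn_coords y) \<noteq> 0 \<and>
           ((\<exists>a b. y = kk a b) \<or> (\<exists>i\<in>{1, 2, 3}. \<exists>c d. y = kx i c d))"
proof -
  have V: "is_direct_sum (carrier G \<times> carrier Z2_squared) (\<lambda>(g, h). \<Gamma> g \<inter> Gamma_SQ h)"
    using compatible by (simp add: compatible_gradings_def)
  have "\<exists>p\<in>carrier G \<times> carrier Z2_squared. \<exists>y\<in>(case p of (g, h) \<Rightarrow> \<Gamma> g \<inter> Gamma_SQ h). f (zorn_coords y) \<noteq> 0"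
    by (rule direct_sum_functional[OF V, where T = "\<lambda>y. f (zorn_coords y)" and z = "zorn t"])
       (use assms in \<open>simp_all add: zorn_coords_add[OF two] zorn_coords_zorn[OF two]\<close>)
  then obtain g h y where "g \<in> carrier G" "y \<in> \<Gamma> g" "y \<in> Gamma_SQ h" "f (zorn_coords y) \<noteq> 0"
    by auto
  then show ?thesis
    using Gamma_SQ_component[OF two] by blast
qed

lemma coords_kk: "zorn_coords (kk a (b::'a)) = (a, b, (0, 0, 0), (0, 0, 0))"
  by (simp add: kk_def zorn_coords_zorn[OF two])

lemma coords_kx: "zorn_coords (kx i c (d::'a)) =
   (0, 0, (of_bool (i = 1) * c, of_bool (i = 2) * c, of_bool (i = 3) * c),
          (of_bool (i = 1) * d, of_bool (i = 2) * d, of_bool (i = 3) * d))"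
  by (simp add: kx_def zorn_coords_zorn[OF two])

text \<open>
  The functional \<open>a + b\<close> vanishes on skew elements and on the \<open>K x\<^sub>i\<close>, so it detects a homogeneous
  element of \<open>K\<close> with nonzero symmetric part. This part is a multiple of \<open>1\<close>, and an idempotent
  can only have neutral degree.
\<close>

lemma q_one_degree: "q_one \<in> \<Gamma> \<one>"
proof -
  let ?f = "\<lambda>(a :: 'a, b :: 'a, cd :: ('a \<times> 'a \<times> 'a) \<times> ('a \<times> 'a \<times> 'a)). a + b"
  have add: "?f (t + u) = ?f t + ?f u" for t u
    by (cases t, cases u) (simp add: algebra_simps)
  have nz: "?f (1, 0, (0, 0, 0), (0, 0, 0)) \<noteq> 0"
    by simp
  obtain g y where g: "g \<in> carrier G" and y: "y \<in> \<Gamma> g"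
    and "?f (zorn_coords y) \<noteq> 0"
    and "(\<exists>a b. y = kk a b) \<or> (\<exists>i\<in>{1, 2, 3}. \<exists>c d. y = kx i c d)"
    using homogeneous_with_coord[of ?f, OF add nz] by blast
  then obtain a b where ab: "y = kk a b" "a + b \<noteq> 0"
    by (auto simp: coords_kk coords_kx)
  have "q_scale (1 / (a + b)) (y + q_inv y) \<in> \<Gamma> g"
    by (intro scale_mem add_mem inv_mem y g)
  then have one: "kk 1 1 \<in> \<Gamma> g"
    using ab(2) by (simp add: ab(1) kk_inv[OF two] kk_add kk_scale add.commute[of b])
  have "kk 1 1 \<in> \<Gamma> (g \<otimes> g)"
    using mult_mem[OF one one g g] by (simp add: kk_kk[OF two])
  then have "g \<otimes> g = g"
    using degree_unique[OF _ _ _ one] g kk_nonzero by (metis m_closed zero_neq_one)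
  then have "g = \<one>"
    using g by simp
  then show ?thesis
    using one by (simp add: q_one_kk[OF two])
qed

text \<open>
  The same with the skew part: \<open>a - b\<close> detects it, and it is a multiple of \<open>s\<close>.
\<close>

lemma q_s_degree: obtains g where "g \<in> carrier G" "q_s \<in> \<Gamma> g" "g \<otimes> g = \<one>"
proof -
  let ?f = "\<lambda>(a :: 'a, b :: 'a, cd :: ('a \<times> 'a \<times> 'a) \<times> ('a \<times> 'a \<times> 'a)). a - b"
  have add: "?f (t + u) = ?f t + ?f u" for t u
    by (cases t, cases u) (simp add: algebra_simps)
  have nz: "?f (1, 0, (0, 0, 0), (0, 0, 0)) \<noteq> 0"
    by simp
  obtain g y where g: "g \<in> carrier G" and y: "y \<in> \<Gamma> g"
    and "?f (zorn_coords y) \<noteq> 0"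
    and "(\<exists>a b. y = kk a b) \<or> (\<exists>i\<in>{1, 2, 3}. \<exists>c d. y = kx i c d)"
    using homogeneous_with_coord[of ?f, OF add nz] by blast
  then obtain a b where ab: "y = kk a b" "a - b \<noteq> 0"
    by (auto simp: coords_kk coords_kx)
  have "q_scale (1 / (a - b)) (y + q_scale (- 1) (q_inv y)) \<in> \<Gamma> g"
    by (intro scale_mem add_mem inv_mem y g)
  then have s: "kk 1 (-1) \<in> \<Gamma> g"
    using ab(2) by (simp add: ab(1) kk_inv[OF two] kk_add kk_scale divide_eq_eq
        minus_diff_eq[of a b, symmetric] del: minus_diff_eq)
  have "kk 1 1 \<in> \<Gamma> (g \<otimes> g)"
    using mult_mem[OF s s g g] by (simp add: kk_kk[OF two])
  then have "g \<otimes> g = \<one>"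
    using degree_unique[of "g \<otimes> g" \<one>] q_one_degree g kk_nonzero[of 1 1] by (simp add: q_one_kk[OF two])
  then show thesis
    using that g s by (simp add: q_s_kk[OF two])
qed

lemma kx_homogeneous_plus:
  assumes i: "i \<in> {1, 2, 3}"
  obtains h c d where "h \<in> carrier G" "kx i c d \<in> \<Gamma> h" "c \<noteq> 0"
proof -
  let ?f = "\<lambda>(a :: 'a, b :: 'a, (c1 :: 'a, c2 :: 'a, c3 :: 'a), d :: 'a \<times> 'a \<times> 'a). if i = 1 then c1 else if i = 2 then c2 else c3"
  have add: "?f (t + u) = ?f t + ?f u" for t u
    by (cases t, cases u) auto
  have nz: "?f (0, 0, (1, 1, 1), (0, 0, 0)) \<noteq> 0"
    by simp
  obtain h y where h: "h \<in> carrier G" and y: "y \<in> \<Gamma> h" and c: "?f (zorn_coords y) \<noteq> 0"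
    and "(\<exists>a b. y = kk a b) \<or> (\<exists>j\<in>{1, 2, 3}. \<exists>c d. y = kx j c d)"
    using homogeneous_with_coord[of ?f, OF add nz] by blast
  then obtain c d where "y = kx i c d" "c \<noteq> 0"
    using i by (auto simp: coords_kk coords_kx split: if_splits)
  then show thesis
    using that h y by blast
qed

lemma kx_homogeneous_minus:
  assumes i: "i \<in> {1, 2, 3}"
  obtains h c d where "h \<in> carrier G" "kx i c d \<in> \<Gamma> h" "d \<noteq> 0"
proof -
  let ?f = "\<lambda>(a :: 'a, b :: 'a, c :: 'a \<times> 'a \<times> 'a, (d1 :: 'a, d2 :: 'a, d3 :: 'a)). if i = 1 then d1 else if i = 2 then d2 else d3"
  have add: "?f (t + u) = ?f t + ?f u" for t u
    by (cases t, cases u) auto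
  have nz: "?f (0, 0, (0, 0, 0), (1, 1, 1)) \<noteq> 0"
    by simp
  obtain h y where h: "h \<in> carrier G" and y: "y \<in> \<Gamma> h" and c: "?f (zorn_coords y) \<noteq> 0"
    and "(\<exists>a b. y = kk a b) \<or> (\<exists>j\<in>{1, 2, 3}. \<exists>c d. y = kx j c d)"
    using homogeneous_with_coord[of ?f, OF add nz] by blast
  then obtain c d where "y = kx i c d" "d \<noteq> 0"
    using i by (auto simp: coords_kk coords_kx split: if_splits)
  then show thesis
    using that h y by blast
qed

text \<open>
  With \<open>e\<^sub>+\<close> and \<open>e\<^sub>-\<close> of degree \<open>e\<close>, the degrees of \<open>p\<^sub>1\<close> and \<open>p\<^sub>2\<close> determine the others through
  \<open>p\<^sub>i m\<^sub>i = e\<^sub>+\<close>, \<open>p\<^sub>1 p\<^sub>2 = m\<^sub>3\<close> and \<open>m\<^sub>1 m\<^sub>2 = p\<^sub>3\<close>.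
\<close>

lemma grading_with_s_of_trivial_degree:
  assumes s: "q_s \<in> \<Gamma> \<one>"
  shows "\<exists>g1\<in>carrier G. \<exists>g2\<in>carrier G. isomorphic_gradings G \<Gamma> (Gamma_SQ2 G g1 g2)"
proof -
  have half: "1 / 2 + 1 / 2 = (1::'a)"
    using two by (simp add: field_simps)
  have "q_scale (1 / 2) q_one + q_scale (1 / 2) q_s \<in> \<Gamma> \<one>"
    by (intro add_mem scale_mem s q_one_degree) simp_all
  then have ep: "kk 1 0 \<in> \<Gamma> \<one>"
    by (simp add: q_one_kk[OF two] q_s_kk[OF two] kk_scale kk_add half)
  have "q_scale (1 / 2) q_one + q_scale (- 1 / 2) q_s \<in> \<Gamma> \<one>"
    by (intro add_mem scale_mem s q_one_degree) simp_all
  then have em: "kk 0 1 \<in> \<Gamma> \<one>"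
    by (simp add: q_one_kk[OF two] q_s_kk[OF two] kk_scale kk_add half)
  \<comment> \<open>Multiplication by \<open>e\<^sub>+\<close> and \<open>e\<^sub>-\<close> isolates \<open>p\<^sub>i\<close> and \<open>m\<^sub>i\<close>, and \<open>p\<^sub>i m\<^sub>i = e\<^sub>+\<close> relates their degrees.\<close>
  have lines: "\<exists>h\<in>carrier G. kx i 1 0 \<in> \<Gamma> h \<and> kx i 0 1 \<in> \<Gamma> (inv h)" if i: "i \<in> {1, 2, 3}" for i
  proof -
    obtain h c d where h: "h \<in> carrier G" "kx i c d \<in> \<Gamma> h" "c \<noteq> 0"
      using kx_homogeneous_plus[OF i] .
    obtain k c' d' where k: "k \<in> carrier G" "kx i c' d' \<in> \<Gamma> k" "d' \<noteq> 0"
      using kx_homogeneous_minus[OF i] .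
    have p: "kx i 1 0 \<in> \<Gamma> h"
      using mult_mem[OF ep h(2) one_closed h(1)] scale_mem[OF h(1), of "kx i c 0" "1 / c"] h
      by (simp add: kk_kx[OF two] kx_scale)
    have m: "kx i 0 1 \<in> \<Gamma> k"
      using mult_mem[OF em k(2) one_closed k(1)] scale_mem[OF k(1), of "kx i 0 d'" "1 / d'"] k
      by (simp add: kk_kx[OF two] kx_scale)
    have "kk 1 0 \<in> \<Gamma> (h \<otimes> k)"
      using mult_mem[OF p m h(1) k(1)] kx_kx_same[OF two i] by simp
    then have "h \<otimes> k = \<one>"
      using degree_unique[of "h \<otimes> k" \<one>] ep h k kk_nonzero[of 1 0] by simp
    then have "k = inv h"
      using h k by (metis inv_equality m_comm)
    then show ?thesis
      using h p m by blast
  qed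
  obtain g1 where g1: "g1 \<in> carrier G" "kx 1 1 0 \<in> \<Gamma> g1" "kx 1 0 1 \<in> \<Gamma> (inv g1)"
    using lines[of 1] by auto
  obtain g2 where g2: "g2 \<in> carrier G" "kx 2 1 0 \<in> \<Gamma> g2" "kx 2 0 1 \<in> \<Gamma> (inv g2)"
    using lines[of 2] by auto
  have m3: "kx 3 0 1 \<in> \<Gamma> (g1 \<otimes> g2)"
    using mult_mem[OF g1(2) g2(2)] g1 g2 by (simp add: kx_kx_12[OF two] del: One_nat_def)
  have p3: "kx 3 1 0 \<in> \<Gamma> (inv (g1 \<otimes> g2))"
    using mult_mem[OF g1(3) g2(3)] g1 g2 by (simp add: kx_kx_12[OF two] inv_mult del: One_nat_def)
  have "isomorphic_gradings G \<Gamma> (Gamma_SQ2 G g1 g2)"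
    unfolding Gamma_SQ2_def[abs_def]
  proof (rule isomorphic_to_grading_from_degrees[OF direct_sum id_automorphism])
    show "g \<in> carrier G \<and> (\<exists>y\<in>\<Gamma> g. id y = x)" if "(x, g) \<in> 
     {(q_one, \<one>), (q_s, \<one>), (e_plus \<bullet>\<^sub>q q_x1, g1), (e_plus \<bullet>\<^sub>q q_x2, g2),
      (e_plus \<bullet>\<^sub>q q_x3, inv (g1 \<otimes> g2)), (e_minus \<bullet>\<^sub>q q_x1, inv g1), (e_minus \<bullet>\<^sub>q q_x2, inv g2),
      (e_minus \<bullet>\<^sub>q q_x3, g1 \<otimes> g2)}" for x g
      using that s q_one_degree g1 g2 m3 p3
      by (auto simp: generators_kk_kx[OF two] kk_kx[OF two])
    show "quartic.span (fst ` {(q_one, \<one>), (q_s, \<one>), (e_plus \<bullet>\<^sub>q q_x1, g1), (e_plus \<bullet>\<^sub>q q_x2, g2),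
      (e_plus \<bullet>\<^sub>q q_x3, inv (g1 \<otimes> g2)), (e_minus \<bullet>\<^sub>q q_x1, inv g1), (e_minus \<bullet>\<^sub>q q_x2, inv g2),
      (e_minus \<bullet>\<^sub>q q_x3, g1 \<otimes> g2)}) = (UNIV :: 'a quartic set)"
      by (rule span_UNIV_criterion[OF two])
         (auto simp: generators_kk_kx[OF two] kk_kx[OF two] intro: quartic.span_base)
  qed simp
  then show ?thesis
    using g1 g2 by blast
qed

text \<open>
  Each \<open>K x\<^sub>i\<close> splits into the two distinct degrees of \<open>u\<close> and \<open>s u\<close> for a homogeneous \<open>u\<close> with
  \<open>u\<^sup>2 = 1\<close>, and an automorphism from the torus carries such elements of \<open>K x\<^sub>1\<close> and \<open>K x\<^sub>2\<close> to
  \<open>x\<^sub>1\<close> and \<open>x\<^sub>2\<close>. Square roots in the field serve to normalise \<open>u\<close>.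
\<close>

lemma grading_with_s_of_nontrivial_degree:
  assumes sqrt: "\<And>c :: 'a. \<exists>r. r ^ 2 = c"
    and g: "g \<in> carrier G" "q_s \<in> \<Gamma> g" "g \<otimes> g = \<one>" "g \<noteq> \<one>"
  shows "\<exists>g1\<in>carrier G. \<exists>g2\<in>carrier G. g1 \<otimes> g1 = \<one> \<and> g2 \<otimes> g2 = \<one> \<and>
           isomorphic_gradings G \<Gamma> (Gamma_SQ3 G g g1 g2)"
proof -
  have s_mult: "kx i c (- d) \<in> \<Gamma> (g \<otimes> h)" if "kx i c d \<in> \<Gamma> h" "h \<in> carrier G" for i c d h
    using mult_mem[OF g(2) that(1) g(1) that(2)] by (simp add: q_s_kk[OF two] kk_kx[OF two])
  have lines: "\<exists>h\<in>carrier G. h \<otimes> h = \<one> \<and> (\<exists>c. c \<noteq> 0 \<and> kx i c (1 / c) \<in> \<Gamma> h)" if i: "i \<in> {1, 2, 3}" for i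
  proof -
    obtain h c d where h: "h \<in> carrier G" "kx i c d \<in> \<Gamma> h" "c \<noteq> 0"
      using kx_homogeneous_plus[OF i] .
    \<comment> \<open>Otherwise \<open>s\<close> would fix the homogeneous element \<open>c p\<^sub>i\<close>.\<close>
    have "d \<noteq> 0"
    proof
      assume "d = 0"
      then have "kx i c d \<in> \<Gamma> (g \<otimes> h)"
        using s_mult[OF h(2,1)] by simp
      then have "g \<otimes> h = h"
        using degree_unique[of "g \<otimes> h" h "kx i c d"] h g kx_nonzero[OF i, of c d] by simp
      then show False
        using g h by simp
    qed
    have "kk (c * d) (d * c) \<in> \<Gamma> (h \<otimes> h)"
      using mult_mem[OF h(2) h(2)] h kx_kx_same[OF two i] by simp
    then have "q_scale (1 / (c * d)) (kk (c * d) (d * c)) \<in> \<Gamma> (h \<otimes> h)"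
      using scale_mem h by simp
    then have "kk 1 1 \<in> \<Gamma> (h \<otimes> h)"
      using \<open>d \<noteq> 0\<close> \<open>c \<noteq> 0\<close> by (simp add: kk_scale mult.commute)
    then have hh: "h \<otimes> h = \<one>"
      using degree_unique[of "h \<otimes> h" \<one>] q_one_degree h kk_nonzero[of 1 1] by (simp add: q_one_kk[OF two])
    \<comment> \<open>Dividing by a square root of \<open>c d\<close> makes the square of the homogeneous element equal to \<open>1\<close>.\<close>
    obtain r where r: "r ^ 2 = c * d"
      using sqrt by blast
    then have "r \<noteq> 0"
      using \<open>d \<noteq> 0\<close> \<open>c \<noteq> 0\<close> by auto
    have "d / r = 1 / (c / r)"
      using r \<open>r \<noteq> 0\<close> \<open>c \<noteq> 0\<close> by (simp add: field_simps power2_eq_square)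
    moreover have "q_scale (1 / r) (kx i c d) = kx i (c / r) (d / r)"
      by (simp add: kx_scale)
    ultimately have "kx i (c / r) (1 / (c / r)) \<in> \<Gamma> h"
      using scale_mem[OF h(1,2), of "1 / r"] by simp
    moreover have "c / r \<noteq> 0"
      using \<open>r \<noteq> 0\<close> \<open>c \<noteq> 0\<close> by simp
    ultimately show ?thesis
      using h hh by blast
  qed
  obtain g1 c1 where g1: "g1 \<in> carrier G" "g1 \<otimes> g1 = \<one>" "c1 \<noteq> 0" "kx 1 c1 (1 / c1) \<in> \<Gamma> g1"
    using lines[of 1] by auto
  obtain g2 c2 where g2: "g2 \<in> carrier G" "g2 \<otimes> g2 = \<one>" "c2 \<noteq> 0" "kx 2 c2 (1 / c2) \<in> \<Gamma> g2"
    using lines[of 2] by auto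
  have u3: "kx 3 (1 / (c1 * c2)) (c1 * c2) \<in> \<Gamma> (g1 \<otimes> g2)"
    using mult_mem[OF g1(4) g2(4)] g1 g2 by (simp add: kx_kx_12[OF two] del: One_nat_def)
  let ?\<phi> = "torus (1 / c1) (1 / c2)"
  note T = torus_kk_kx[OF two]
  have one: "\<exists>y\<in>\<Gamma> \<one>. ?\<phi> y = kk 1 1"
    using q_one_degree by (intro bexI[of _ "kk 1 1"]) (simp_all add: T q_one_kk[OF two])
  have s: "\<exists>y\<in>\<Gamma> g. ?\<phi> y = kk 1 (- 1)"
    using g by (intro bexI[of _ "kk 1 (- 1)"]) (simp_all add: T q_s_kk[OF two])
  have x1: "\<exists>y\<in>\<Gamma> g1. ?\<phi> y = kx 1 1 1"
    using g1 by (intro bexI[OF _ g1(4)]) (simp add: T del: One_nat_def)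
  have x2: "\<exists>y\<in>\<Gamma> g2. ?\<phi> y = kx 2 1 1"
    using g2 by (intro bexI[OF _ g2(4)]) (simp add: T del: One_nat_def)
  have x3: "\<exists>y\<in>\<Gamma> (g1 \<otimes> g2). ?\<phi> y = kx 3 1 1"
    using g1 g2 by (intro bexI[OF _ u3]) (simp add: T del: One_nat_def)
  have sx1: "\<exists>y\<in>\<Gamma> (g \<otimes> g1). ?\<phi> y = kx 1 1 (- 1)"
    using g1 by (intro bexI[OF _ s_mult[OF g1(4,1)]]) (simp add: T del: One_nat_def)
  have sx2: "\<exists>y\<in>\<Gamma> (g \<otimes> g2). ?\<phi> y = kx 2 1 (- 1)"
    using g2 by (intro bexI[OF _ s_mult[OF g2(4,1)]]) (simp add: T del: One_nat_def)
  have sx3: "\<exists>y\<in>\<Gamma> (g \<otimes> (g1 \<otimes> g2)). ?\<phi> y = kx 3 1 (- 1)"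
    using g1 g2 by (intro bexI[OF _ s_mult[OF u3]]) (simp_all add: T del: One_nat_def)
  have "isomorphic_gradings G \<Gamma> (Gamma_SQ3 G g g1 g2)"
    unfolding Gamma_SQ3_def[abs_def]
  proof (rule isomorphic_to_grading_from_degrees[OF direct_sum torus_automorphism[OF two]])
    show "1 / c1 \<noteq> 0" "1 / c2 \<noteq> 0"
      using g1 g2 by simp_all
    show "k \<in> carrier G \<and> (\<exists>y\<in>\<Gamma> k. ?\<phi> y = x)" if "(x, k) \<in> 
     {(q_one, \<one>), (q_s, g), (q_x1, g1), (q_x2, g2), (q_x3, g1 \<otimes> g2),
      (q_s \<bullet>\<^sub>q q_x1, g \<otimes> g1), (q_s \<bullet>\<^sub>q q_x2, g \<otimes> g2), (q_s \<bullet>\<^sub>q q_x3, g \<otimes> g1 \<otimes> g2)}" for x k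
      using that one s x1 x2 x3 sx1 sx2 sx3 g g1(1) g2(1)
      by (auto simp: generators_kk_kx[OF two] kk_kx[OF two] m_assoc)
    show "quartic.span (fst ` {(q_one, \<one>), (q_s, g), (q_x1, g1), (q_x2, g2), (q_x3, g1 \<otimes> g2),
      (q_s \<bullet>\<^sub>q q_x1, g \<otimes> g1), (q_s \<bullet>\<^sub>q q_x2, g \<otimes> g2), (q_s \<bullet>\<^sub>q q_x3, g \<otimes> g1 \<otimes> g2)}) = (UNIV :: 'a quartic set)"
      by (rule span_UNIV_criterion[OF two])
         (auto simp: generators_kk_kx[OF two] kk_kx[OF two] intro: quartic.span_base)
  qed simp
  then show ?thesis
    using g1 g2 by blast
qed

end

theorem proposition4p8:
  fixes G :: "('g, 'm) monoid_scheme"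
    and \<Gamma> :: "'g \<Rightarrow> 'a::alg_closed_field quartic set"
  assumes "CHAR('a) \<notin> {2, 3, 5}"
    and "comm_group G"
    and "is_grading G \<Gamma>"
    and "compatible_gradings G \<Gamma> Z2_squared Gamma_SQ"
  shows "(\<exists>g1\<in>carrier G. \<exists>g2\<in>carrier G. isomorphic_gradings G \<Gamma> (Gamma_SQ2 G g1 g2)) \<or>
         (\<exists>g\<in>carrier G. \<exists>g1\<in>carrier G. \<exists>g2\<in>carrier G.
            group.ord G g = 2 \<and> g1 [^]\<^bsub>G\<^esub> (2::nat) = \<one>\<^bsub>G\<^esub> \<and> g2 [^]\<^bsub>G\<^esub> (2::nat) = \<one>\<^bsub>G\<^esub> \<and>
            isomorphic_gradings G \<Gamma> (Gamma_SQ3 G g g1 g2))"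
proof -
  interpret comm_group G
    by fact
  have two: "(2::'a) \<noteq> 0"
  proof
    assume "(2::'a) = 0"
    then have "CHAR('a) dvd 2"
      using of_nat_eq_0_iff_char_dvd[where 'a = 'a, of 2] by simp
    then have "CHAR('a) \<in> {1, 2}"
      by (metis One_nat_def insertCI two_is_prime_nat prime_nat_iff)
    then show False
      using assms(1) CHAR_not_1 by auto
  qed
  interpret SQ_compatible_grading G \<Gamma>
    by unfold_locales (fact two assms)+
  obtain g where g: "g \<in> carrier G" "q_s \<in> \<Gamma> g" "g \<otimes>\<^bsub>G\<^esub> g = \<one>\<^bsub>G\<^esub>"
    by (rule q_s_degree)
  show ?thesis
  proof (cases "g = \<one>\<^bsub>G\<^esub>")
    case True
    then show ?thesis
      using grading_with_s_of_trivial_degree g by blast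
  next
    case False
    have sq: "k [^]\<^bsub>G\<^esub> (2::nat) = k \<otimes>\<^bsub>G\<^esub> k" if "k \<in> carrier G" for k
      using that by (simp add: numeral_2_eq_2)
    have "ord g dvd 2"
      using g sq[of g] by (intro pow_eq_id[THEN iffD1]) simp_all
    moreover have "ord g \<noteq> 1"
      using g False ord_eq_1 by blast
    ultimately have "ord g = 2"
      by (metis two_is_prime_nat prime_nat_iff)
    moreover have "\<exists>r. r ^ 2 = c" for c :: 'a
      using nth_root_exists[of 2 c] by auto
    ultimately show ?thesis
      using grading_with_s_of_nontrivial_degree[OF _ g False] g sq by metis
  qed
qed

end
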